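(* Let $X$ be a finite square-free cycle set, let $S$ be a finite nonempty set and let $\alpha\in Z^2(X,S)$ be a dynamical cocycle with $\alpha_{x,x}(s,s)=s$ for all $x\in X$ and $s\in S$. Assume that $X$ is not a multipermutation cycle set. Then the dynamical extension $S\times_\alpha X$ is square-free and it is not a multipermutation cycle set.
   Context: A cycle set is a set $X$ with a binary operation $(x,y)\mapsto x\cdot y$ such that for each $x\in X$ the map $y\mapsto x\cdot y$ is bijective and $(x\cdot y)\cdot(x\cdot z)=(y\cdot x)\cdot(y\cdot z)$ for all $x,y,z\in X$. It is square-free if $x\cdot x=x$ for all $x\in X$. Let $X$ be a finite cycle set, $S$ a finite nonempty set, and $\operatorname{Sym}(S)$ the set of permutations of $S$. A dynamical cocycle of $X$ with values on $S$ is a map $\alpha\colon X\times X\times S\to \operatorname{Sym}(S)$, $(x,y,s)\mapsto\alpha_{x,y}(s,-)$ (where $\alpha_{x,y}(s,-)$ denotes the map $t\mapsto\alpha_{x,y}(s,t)$), such that $$\alpha_{x\cdot y,x\cdot z}(\alpha_{x,y}(r,s),\alpha_{x,z}(r,t))=\alpha_{y\cdot x,y\cdot z}(\alpha_{y,x}(s,r),\alpha_{y,z}(s,t))$$ for all $x,y,z\in X$, $r,s,t\in S$. The set of these is denoted $Z^2(X,S)$. The dynamical extension $S\times_\alpha X$ is the set $S\times X$ with the operation $(s,x)\cdot(t,y)=(\alpha_{x,y}(s,t),x\cdot y)$; it is a cycle set. A solution means a finite nondegenerate involutive set-theoretic solution of the Yang--Baxter equation: a pair $(X,r)$ with $X$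 a finite nonempty set and $r\colon X\times X\to X\times X$ bijective, $r(x,y)=(\sigma_x(y),\tau_y(x))$, such that $r_{12}r_{23}r_{12}=r_{23}r_{12}r_{23}$ (where $r_{12}=r\times\operatorname{id}$, $r_{23}=\operatorname{id}\times r$), $r^2=\operatorname{id}$, and all $\sigma_x,\tau_x$ are bijective. Finite cycle sets correspond bijectively to solutions via $r_X(x,y)=((y*x)\cdot y,\,y*x)$, where $y*x=z$ if and only if $x=y\cdot z$. The retract relation on a solution $(X,r)$ is $x\sim y$ if and only if $\sigma_x=\sigma_y$, and the retraction $\operatorname{Ret}(X,r)$ is the solution on $X/{\sim}$ given by $\overline r([x],[y])=([\sigma_x(y)],[\tau_y(x)])$. Iterated retractions are $\operatorname{Ret}^1=\operatorname{Ret}$ and $\operatorname{Ret}^k(X,r)=\operatorname{Ret}(\operatorname{Ret}^{k-1}(X,r))$ for $k>1$. $(X,r)$ is a multipermutation solution if there is $m>0$ such that $\operatorname{Ret}^m(X,r)$ has cardinality one. A cycle set $X$ is a multipermutation cycle set if its corresponding solution $(X,r_X)$ is a multipermutation solution. *)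

theory Defs
  imports Main "HOL-Library.FSet"
begin

definition cycle_set :: "'a set \<Rightarrow> ('a \<Rightarrow> 'a \<Rightarrow> 'a) \<Rightarrow> bool" where
  "cycle_set X f \<longleftrightarrow>
     (\<forall>x\<in>X. bij_betw (f x) X X) \<and>
     (\<forall>x\<in>X. \<forall>y\<in>X. \<forall>z\<in>X. f (f x y) (f x z) = f (f y x) (f y z))"

definition square_free :: "'a set \<Rightarrow> ('a \<Rightarrow> 'a \<Rightarrow> 'a) \<Rightarrow> bool" where
  "square_free X f \<longleftrightarrow> (\<forall>x\<in>X. f x x = x)"

text \<open>The value \<open>\<alpha>\<^bsub>x,y\<^esub>(s,t)\<close> is written \<open>\<alpha> x y s t\<close>.\<close>

definition dynamical_cocycle ::
  "'x set \<Rightarrow> ('x \<Rightarrow> 'x \<Rightarrow> 'x) \<Rightarrow> 's set \<Rightarrow> ('x \<Rightarrow> 'x \<Rightarrow> 's \<Rightarrow> 's \<Rightarrow> 's) \<Rightarrow> bool" where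
  "dynamical_cocycle X f S \<alpha> \<longleftrightarrow>
     (\<forall>x\<in>X. \<forall>y\<in>X. \<forall>s\<in>S. bij_betw (\<alpha> x y s) S S) \<and>
     (\<forall>x\<in>X. \<forall>y\<in>X. \<forall>z\<in>X. \<forall>r\<in>S. \<forall>s\<in>S. \<forall>t\<in>S.
        \<alpha> (f x y) (f x z) (\<alpha> x y r s) (\<alpha> x z r t) =
        \<alpha> (f y x) (f y z) (\<alpha> y x s r) (\<alpha> y z s t))"

definition dyn_ext_op ::
  "('x \<Rightarrow> 'x \<Rightarrow> 'x) \<Rightarrow> ('x \<Rightarrow> 'x \<Rightarrow> 's \<Rightarrow> 's \<Rightarrow> 's) \<Rightarrow> 's \<times> 'x \<Rightarrow> 's \<times> 'x \<Rightarrow> 's \<times> 'x" where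
  "dyn_ext_op f \<alpha> = (\<lambda>(s, x) (t, y). (\<alpha> x y s t, f x y))"

text \<open>A pair \<open>(X, r)\<close>; only the values of \<open>r\<close> on \<open>X \<times> X\<close> matter. The components of
  \<open>r (x, y)\<close> are \<open>\<sigma>\<^sub>x(y)\<close> and \<open>\<tau>\<^sub>y(x)\<close>.\<close>

type_synonym 'a ybe_pair = "'a set \<times> ('a \<times> 'a \<Rightarrow> 'a \<times> 'a)"

definition cycle_star :: "'a set \<Rightarrow> ('a \<Rightarrow> 'a \<Rightarrow> 'a) \<Rightarrow> 'a \<Rightarrow> 'a \<Rightarrow> 'a" where
  "cycle_star X f y x = (THE z. z \<in> X \<and> x = f y z)"

definition cycle_solution :: "'a set \<Rightarrow> ('a \<Rightarrow> 'a \<Rightarrow> 'a) \<Rightarrow> 'a ybe_pair" where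
  "cycle_solution X f =
     (X, \<lambda>(x, y). (f (cycle_star X f y x) y, cycle_star X f y x))"

definition retract_rel :: "'a ybe_pair \<Rightarrow> ('a \<times> 'a) set" where
  "retract_rel = (\<lambda>(X, r).
     {(x, y). x \<in> X \<and> y \<in> X \<and> (\<forall>z\<in>X. fst (r (x, z)) = fst (r (y, z)))})"

text \<open>The induced map on classes does not depend on the representatives when \<open>(X, r)\<close> is a
  finite nondegenerate involutive solution, so the definite description below is then
  well defined.\<close>

definition ret :: "'a ybe_pair \<Rightarrow> 'a set ybe_pair" where
  "ret = (\<lambda>(X, r). let R = retract_rel (X, r) in
     (X // R,
      \<lambda>(A, B). THE p. \<exists>x\<in>A. \<exists>y\<in>B. p = (R `` {fst (r (x, y))}, R `` {snd (r (x, y))})))"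

text \<open>\<^const>\<open>ret\<close> changes the type of the elements, so it cannot be iterated directly. The following
  type contains the points of \<open>X\<close>, finite classes of points, finite classes of such classes,
  and so on; along the injections \<open>Point\<close> and \<open>Class \<circ> Abs_fset\<close> (the latter injective on
  finite sets) all iterated retractions of a finite pair live on it.\<close>

datatype 'a iterated_class = Point 'a | Class "'a iterated_class fset"

text \<open>The pair obtained from \<open>(X, r)\<close> by renaming its elements along a map injective on \<open>X\<close>.\<close>

definition transport :: "('a \<Rightarrow> 'b) \<Rightarrow> 'a ybe_pair \<Rightarrow> 'b ybe_pair" where
  "transport h = (\<lambda>(X, r).
     (h ` X, map_prod h h \<circ> r \<circ> map_prod (inv_into X h) (inv_into X h)))"

definition ret_iter :: "nat \<Rightarrow> 'a ybe_pair \<Rightarrow> 'a iterated_class ybe_pair" where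
  "ret_iter k P = ((\<lambda>Q. transport (Class \<circ> Abs_fset) (ret Q)) ^^ k) (transport Point P)"

definition multipermutation_solution :: "'a ybe_pair \<Rightarrow> bool" where
  "multipermutation_solution P \<longleftrightarrow> (\<exists>m>0. card (fst (ret_iter m P)) = 1)"

definition multipermutation_cycle_set :: "'a set \<Rightarrow> ('a \<Rightarrow> 'a \<Rightarrow> 'a) \<Rightarrow> bool" where
  "multipermutation_cycle_set X f \<longleftrightarrow> multipermutation_solution (cycle_solution X f)"

end

theory Submission
  imports Defs
begin

text \<open>
  The projection \<open>S \<times> X \<rightarrow> X\<close> is a surjective homomorphism of cycle sets, and a surjective
  homomorphic image of a multipermutation solution is again a multipermutation solution: a
  surjective homomorphism \<open>P \<rightarrow> Q\<close> maps retract-equivalent points to retract-equivalent points,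
  so it induces a surjective homomorphism \<open>Ret P \<rightarrow> Ret Q\<close>; by iteration \<open>Ret\<^sup>m P\<close> maps onto
  \<open>Ret\<^sup>m Q\<close> for every \<open>m\<close>, and the image of a one-point set has one point. Hence if the
  extension were a multipermutation cycle set, so would be \<open>X\<close>.

  What needs care is that the retraction is well defined at every stage, that is, that
  retract equivalence is a congruence. Square-freeness makes this short. The cycle law gives
  \<open>(y \<cdot> z) \<cdot> (y \<cdot> y) = (z \<cdot> y) \<cdot> (z \<cdot> y)\<close>, and with \<open>x = y \<cdot> z\<close> this reads \<open>x \<cdot> y = z \<cdot> y\<close>,
  where the right-hand side is \<open>\<sigma>\<^sub>x(y)\<close> by definition. So in the solution of a square-free cycle
  set \<open>\<sigma>\<^sub>x\<close> is simply the left translation by \<open>x\<close>, and the retract relation identifies points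
  with the same left translation (lemma \<open>square_free_solution_cycle_solution\<close>). That this
  relation is compatible with \<open>\<sigma>\<close> is a consequence of the cycle law
  (\<open>retract_rel_left_op\<close>), and compatibility with \<open>\<tau>\<close> follows by finiteness
  (\<open>retract_rel_right_op\<close>). Since finite square-free solutions are closed under homomorphic
  images (\<open>square_free_solution_image\<close>), they are closed under retraction, and the induction
  on the number of retractions goes through (\<open>solution_epi_ret_iter\<close>).
\<close>

section \<open>Square-free solutions\<close>

definition left_op :: "'a ybe_pair \<Rightarrow> 'a \<Rightarrow> 'a \<Rightarrow> 'a" where
  "left_op P x y = fst (snd P (x, y))"

definition right_op :: "'a ybe_pair \<Rightarrow> 'a \<Rightarrow> 'a \<Rightarrow> 'a" where
  "right_op P y x = snd (snd P (x, y))"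

text \<open>The solutions of finite square-free cycle sets, described without reference to a cycle
  set: the operation of the latter is recovered as \<open>x \<cdot> y = \<sigma>\<^sub>x(y)\<close>, and \<open>\<tau>\<^sub>y\<close> inverts the left
  translation by \<open>y\<close>. Only values on the carrier are constrained, because the
  maps produced by \<^const>\<open>ret\<close> and \<^const>\<open>transport\<close> are arbitrary elsewhere.\<close>

definition square_free_solution :: "'a ybe_pair \<Rightarrow> bool" where
  "square_free_solution P \<longleftrightarrow>
     finite (fst P) \<and> cycle_set (fst P) (left_op P) \<and> square_free (fst P) (left_op P) \<and>
     (\<forall>x\<in>fst P. \<forall>y\<in>fst P. right_op P y x \<in> fst P \<and> left_op P y (right_op P y x) = x)"

lemma square_free_solutionD:
  assumes "square_free_solution P"
  shows "finite (fst P)"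
    and "x \<in> fst P \<Longrightarrow> bij_betw (left_op P x) (fst P) (fst P)"
    and "x \<in> fst P \<Longrightarrow> y \<in> fst P \<Longrightarrow> left_op P x y \<in> fst P"
    and "x \<in> fst P \<Longrightarrow> y \<in> fst P \<Longrightarrow> z \<in> fst P \<Longrightarrow>
      left_op P (left_op P x y) (left_op P x z) = left_op P (left_op P y x) (left_op P y z)"
    and "x \<in> fst P \<Longrightarrow> left_op P x x = x"
    and "x \<in> fst P \<Longrightarrow> y \<in> fst P \<Longrightarrow> right_op P y x \<in> fst P"
    and "x \<in> fst P \<Longrightarrow> y \<in> fst P \<Longrightarrow> left_op P y (right_op P y x) = x"
  using assms
  by (auto simp: square_free_solution_def cycle_set_def square_free_def bij_betw_apply)

text \<open>With \<open>z = y * x\<close>, square-freeness collapses the cycle law for \<open>y, z, y\<close> to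
  \<open>x \<cdot> y = z \<cdot> y\<close>, which is why the first component of the solution is the cycle set operation
  itself.\<close>

lemma square_free_solution_cycle_solution:
  assumes "finite X" and cs: "cycle_set X f" and sf: "square_free X f"
  shows "square_free_solution (cycle_solution X f)"
    and "x \<in> X \<Longrightarrow> y \<in> X \<Longrightarrow> left_op (cycle_solution X f) x y = f x y"
proof -
  let ?P = "cycle_solution X f"
  have star: "cycle_star X f y x \<in> X \<and> f y (cycle_star X f y x) = x"
    if x: "x \<in> X" and y: "y \<in> X" for x y
  proof -
    have bij: "bij_betw (f y) X X"
      using cs y by (auto simp: cycle_set_def)
    have "\<exists>!z. z \<in> X \<and> x = f y z"
      using bij x by (auto simp: bij_betw_def inj_on_def)
    from theI'[OF this] show ?thesis
      by (simp add: cycle_star_def)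
  qed
  have left: "left_op ?P x y = f x y" if x: "x \<in> X" and y: "y \<in> X" for x y
  proof -
    define z where "z = cycle_star X f y x"
    have z: "z \<in> X" "f y z = x"
      using star[OF x y] by (auto simp: z_def)
    have zy: "f z y \<in> X"
      using cs z(1) y by (auto simp: cycle_set_def bij_betw_apply)
    have "f x y = f (f y z) (f y y)"
      using z sf y by (simp add: square_free_def)
    also have "\<dots> = f (f z y) (f z y)"
      using cs y z(1) unfolding cycle_set_def by blast
    also have "\<dots> = f z y"
      using sf zy by (simp add: square_free_def)
    finally show ?thesis
      by (simp add: left_op_def cycle_solution_def z_def)
  qed
  then show "x \<in> X \<Longrightarrow> y \<in> X \<Longrightarrow> left_op ?P x y = f x y" .
  have carrier: "fst ?P = X"
    by (simp add: cycle_solution_def)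
  have right: "right_op ?P y x = cycle_star X f y x" for x y
    by (simp add: right_op_def cycle_solution_def)
  have bij: "bij_betw (left_op ?P x) X X" if x: "x \<in> X" for x
  proof -
    have "bij_betw (f x) X X"
      using cs x by (simp add: cycle_set_def)
    then show ?thesis
      using bij_betw_cong[of X "left_op ?P x" "f x" X] left x by blast
  qed
  have closed: "f x y \<in> X" if "x \<in> X" "y \<in> X" for x y
    using cs that by (auto simp: cycle_set_def bij_betw_apply)
  have law: "f (f x y) (f x z) = f (f y x) (f y z)" if "x \<in> X" "y \<in> X" "z \<in> X" for x y z
    using cs that unfolding cycle_set_def by blast
  have "cycle_set X (left_op ?P)"
    using bij law by (simp add: cycle_set_def left closed)
  moreover have "square_free X (left_op ?P)"
    using sf by (simp add: square_free_def left)
  ultimately show "square_free_solution ?P"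
    unfolding square_free_solution_def carrier using \<open>finite X\<close> star by (simp add: right left)
qed

section \<open>Surjective homomorphisms\<close>

definition solution_epi :: "('a \<Rightarrow> 'b) \<Rightarrow> 'a ybe_pair \<Rightarrow> 'b ybe_pair \<Rightarrow> bool" where
  "solution_epi h P Q \<longleftrightarrow> fst Q = h ` fst P \<and>
     (\<forall>x\<in>fst P. \<forall>y\<in>fst P. snd Q (h x, h y) = map_prod h h (snd P (x, y)))"

lemma solution_epiD:
  assumes "solution_epi h P Q"
  shows "fst Q = h ` fst P"
    and "x \<in> fst P \<Longrightarrow> y \<in> fst P \<Longrightarrow> left_op Q (h x) (h y) = h (left_op P x y)"
    and "x \<in> fst P \<Longrightarrow> y \<in> fst P \<Longrightarrow> right_op Q (h y) (h x) = h (right_op P y x)"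
  using assms by (auto simp: solution_epi_def left_op_def right_op_def)

lemma solution_epiI:
  assumes "fst Q = h ` fst P"
    and "\<And>x y. x \<in> fst P \<Longrightarrow> y \<in> fst P \<Longrightarrow> left_op Q (h x) (h y) = h (left_op P x y)"
    and "\<And>x y. x \<in> fst P \<Longrightarrow> y \<in> fst P \<Longrightarrow> right_op Q (h y) (h x) = h (right_op P y x)"
  shows "solution_epi h P Q"
  using assms by (auto simp: solution_epi_def left_op_def right_op_def prod_eq_iff)

lemma solution_epi_comp:
  assumes g: "solution_epi g P Q" and h: "solution_epi h Q R"
  shows "solution_epi (h \<circ> g) P R"
  by (rule solution_epiI) (use solution_epiD[OF g] solution_epiD[OF h] in auto)

text \<open>Equations pass to the image. Left translations of the image are only seen to be surjective,
  and finiteness makes them bijective.\<close>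

lemma square_free_solution_image:
  assumes P: "square_free_solution P" and h: "solution_epi h P Q"
  shows "square_free_solution Q"
proof -
  note PD = square_free_solutionD[OF P] and hD = solution_epiD[OF h]
  have fin: "finite (fst Q)"
    using PD(1) hD(1) by simp
  have bij: "bij_betw (left_op Q (h x)) (fst Q) (fst Q)" if x: "x \<in> fst P" for x
  proof -
    have "left_op Q (h x) ` fst Q = h ` (left_op P x ` fst P)"
      using hD x by (force simp: image_image)
    also have "\<dots> = fst Q"
      using PD(2)[OF x] hD(1) by (simp add: bij_betw_def)
    finally have "left_op Q (h x) ` fst Q = fst Q" .
    then show ?thesis
      using fin by (simp add: bij_betw_def finite_surj_inj)
  qed
  have law: "left_op Q (left_op Q (h x) (h y)) (left_op Q (h x) (h z)) =
      left_op Q (left_op Q (h y) (h x)) (left_op Q (h y) (h z))"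
    if "x \<in> fst P" "y \<in> fst P" "z \<in> fst P" for x y z
    using that by (simp add: hD(2) PD(3) PD(4))
  have "cycle_set (fst Q) (left_op Q)"
    unfolding cycle_set_def using bij by (auto simp: hD(1) intro: law)
  moreover have "square_free (fst Q) (left_op Q)"
    by (auto simp: square_free_def hD PD)
  moreover have "\<forall>x\<in>fst Q. \<forall>y\<in>fst Q. right_op Q y x \<in> fst Q \<and> left_op Q y (right_op Q y x) = x"
    by (auto simp: hD PD)
  ultimately show ?thesis
    using fin by (simp add: square_free_solution_def)
qed

lemma solution_epi_transport:
  assumes P: "square_free_solution P" and inj: "inj_on h (fst P)"
  shows "solution_epi h P (transport h P)"
    and "solution_epi (inv_into (fst P) h) (transport h P) P"
proof -
  show epi: "solution_epi h P (transport h P)"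
    using inj by (cases P) (auto simp: solution_epi_def transport_def)
  note PD = square_free_solutionD[OF P] and eD = solution_epiD[OF epi]
  show "solution_epi (inv_into (fst P) h) (transport h P) P"
    by (rule solution_epiI) (auto simp: eD PD inj image_image)
qed

section \<open>Retraction\<close>

lemma retract_rel_iff:
  "(x, y) \<in> retract_rel P \<longleftrightarrow>
     x \<in> fst P \<and> y \<in> fst P \<and> (\<forall>z\<in>fst P. left_op P x z = left_op P y z)"
  by (cases P) (simp add: retract_rel_def left_op_def)

lemma equiv_retract_rel: "equiv (fst P) (retract_rel P)"
  by (rule equivI) (auto simp: refl_on_def sym_def trans_def retract_rel_iff)

text \<open>If \<open>y\<close> and \<open>y'\<close> have the same left translation then so have \<open>x \<cdot> y\<close> and \<open>x \<cdot> y'\<close>, because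
  \<open>(x \<cdot> y) \<cdot> (x \<cdot> z) = (y \<cdot> x) \<cdot> (y \<cdot> z)\<close> depends on \<open>y\<close> only through its left translation, and
  every point has the form \<open>x \<cdot> z\<close>.\<close>

lemma retract_rel_left_op:
  assumes P: "square_free_solution P"
    and x: "(x, x') \<in> retract_rel P" and y: "(y, y') \<in> retract_rel P"
  shows "(left_op P x y, left_op P x' y') \<in> retract_rel P"
proof -
  note PD = square_free_solutionD[OF P]
  have mem: "x \<in> fst P" "x' \<in> fst P" "y \<in> fst P" "y' \<in> fst P"
    using x y by (auto simp: retract_rel_iff)
  have "left_op P (left_op P x y) w = left_op P (left_op P x y') w" if w: "w \<in> fst P" for w
  proof -
    obtain z where z: "z \<in> fst P" "w = left_op P x z"
      using PD(2)[OF mem(1)] w by (auto simp: bij_betw_def)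
    have "left_op P (left_op P x y) w = left_op P (left_op P y x) (left_op P y z)"
      unfolding z(2) by (rule PD(4)[OF mem(1,3) z(1)])
    also have "\<dots> = left_op P (left_op P y' x) (left_op P y' z)"
      using y mem(1) z(1) by (simp add: retract_rel_iff)
    also have "\<dots> = left_op P (left_op P x y') w"
      unfolding z(2) by (rule PD(4)[OF mem(4,1) z(1)])
    finally show ?thesis .
  qed
  moreover have "left_op P x' y' = left_op P x y'"
    using x mem by (simp add: retract_rel_iff)
  ultimately show ?thesis
    using mem PD(3) by (simp add: retract_rel_iff)
qed

text \<open>A permutation that preserves a relation on a finite set also reflects it, since it acts
  injectively, hence surjectively, on the finitely many related pairs. For the left translation
  by \<open>y\<close> this says that its inverse, the right operation, preserves retract equivalence.\<close>

lemma retract_rel_right_op: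
  assumes P: "square_free_solution P"
    and x: "(x, x') \<in> retract_rel P" and y: "(y, y') \<in> retract_rel P"
  shows "(right_op P y x, right_op P y' x') \<in> retract_rel P"
proof -
  note PD = square_free_solutionD[OF P]
  let ?R = "retract_rel P" and ?m = "map_prod (left_op P y) (left_op P y)"
  let ?z = "right_op P y x" and ?z' = "right_op P y' x'"
  have mem: "x \<in> fst P" "x' \<in> fst P" "y \<in> fst P" "y' \<in> fst P"
    using x y by (auto simp: retract_rel_iff)
  have z: "?z \<in> fst P" "?z' \<in> fst P"
    using PD(6)[OF mem(1,3)] PD(6)[OF mem(2,4)] by auto
  have sub: "?R \<subseteq> fst P \<times> fst P"
    by (auto simp: retract_rel_iff)
  have inj: "inj_on ?m (fst P \<times> fst P)"
    using PD(2)[OF mem(3)] by (intro map_prod_inj_on) (simp_all add: bij_betw_def)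
  have yy: "(y, y) \<in> ?R"
    using mem(3) by (simp add: retract_rel_iff)
  have "?m ` ?R \<subseteq> ?R"
  proof safe
    fix u v
    assume "(u, v) \<in> ?R"
    then show "(left_op P y u, left_op P y v) \<in> ?R"
      by (rule retract_rel_left_op[OF P yy])
  qed
  moreover have "finite ?R"
    by (rule finite_subset[OF sub]) (simp add: PD(1))
  ultimately have onto: "?m ` ?R = ?R"
    using inj_on_subset[OF inj sub] by (intro endo_inj_surj)
  have "left_op P y ?z' = x'"
    using y z(2) PD(7)[OF mem(2,4)] by (metis retract_rel_iff)
  then have image: "?m (?z, ?z') \<in> ?m ` ?R"
    unfolding onto map_prod_simp PD(7)[OF mem(1,3)] using x by simp
  have "(?z, ?z') \<in> fst P \<times> fst P"
    using z by simp
  from inj_on_image_mem_iff[OF inj this sub] image show ?thesis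
    by (rule iffD1)
qed

text \<open>The two congruence properties make the definite description in \<^const>\<open>ret\<close> well defined,
  which is the existence of the canonical projection onto the retraction.\<close>

lemma solution_epi_ret:
  assumes P: "square_free_solution P"
  shows "solution_epi (\<lambda>x. retract_rel P `` {x}) P (ret P)"
proof -
  let ?R = "retract_rel P" and ?c = "\<lambda>x. retract_rel P `` {x}"
  have carrier: "fst (ret P) = ?c ` fst P"
    by (cases P) (auto simp: ret_def Let_def quotient_def)
  have "snd (ret P) (?c x, ?c y) = map_prod ?c ?c (snd P (x, y))"
    if x: "x \<in> fst P" and y: "y \<in> fst P" for x y
  proof -
    have "snd (ret P) (?c x, ?c y) =
        (THE p. \<exists>u\<in>?c x. \<exists>v\<in>?c y. p = (?c (left_op P u v), ?c (right_op P v u)))"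
      by (cases P) (simp add: ret_def Let_def left_op_def right_op_def)
    also have "\<dots> = (?c (left_op P x y), ?c (right_op P y x))"
    proof (rule the_equality)
      show "\<exists>u\<in>?c x. \<exists>v\<in>?c y.
          (?c (left_op P x y), ?c (right_op P y x)) = (?c (left_op P u v), ?c (right_op P v u))"
        using equiv_class_self[OF equiv_retract_rel x] equiv_class_self[OF equiv_retract_rel y]
        by blast
    next
      fix p
      assume "\<exists>u\<in>?c x. \<exists>v\<in>?c y. p = (?c (left_op P u v), ?c (right_op P v u))"
      then obtain u v where uv: "(x, u) \<in> ?R" "(y, v) \<in> ?R"
        and p: "p = (?c (left_op P u v), ?c (right_op P v u))"
        by auto
      have "?c (left_op P x y) = ?c (left_op P u v)"
        by (rule equiv_class_eq[OF equiv_retract_rel retract_rel_left_op[OF P uv]])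
      moreover have "?c (right_op P y x) = ?c (right_op P v u)"
        by (rule equiv_class_eq[OF equiv_retract_rel retract_rel_right_op[OF P uv]])
      ultimately show "p = (?c (left_op P x y), ?c (right_op P y x))"
        using p by simp
    qed
    finally show ?thesis
      by (simp add: left_op_def right_op_def map_prod_def split_beta)
  qed
  then show ?thesis
    using carrier by (simp add: solution_epi_def)
qed

text \<open>Surjectivity of \<open>h\<close> is what makes it respect retract equivalence: left translations of \<open>Q\<close>
  need only be compared at points \<open>h z\<close>. The induced map sends a class \<open>A\<close> to the saturation of
  \<open>h ` A\<close>, which avoids choosing representatives.\<close>

lemma solution_epi_ret_induced:
  assumes P: "square_free_solution P" and h: "solution_epi h P Q"
  shows "solution_epi (\<lambda>A. retract_rel Q `` (h ` A)) (ret P) (ret Q)"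
proof -
  let ?g = "\<lambda>A. retract_rel Q `` (h ` A)"
  let ?c = "\<lambda>x. retract_rel P `` {x}" and ?d = "\<lambda>x. retract_rel Q `` {x}"
  note PD = square_free_solutionD[OF P] and hD = solution_epiD[OF h]
  have Q: "square_free_solution Q"
    by (rule square_free_solution_image[OF P h])
  note cD = solution_epiD[OF solution_epi_ret[OF P]]
    and dD = solution_epiD[OF solution_epi_ret[OF Q]]
  have g: "?g (?c x) = ?d (h x)" if x: "x \<in> fst P" for x
  proof -
    have "?d (h u) = ?d (h x)" if "(x, u) \<in> retract_rel P" for u
    proof (rule equiv_class_eq[OF equiv_retract_rel])
      have "left_op Q (h u) (h z) = left_op Q (h x) (h z)" if "z \<in> fst P" for z
        using that x \<open>(x, u) \<in> retract_rel P\<close> by (simp add: hD(2) retract_rel_iff)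
      then show "(h u, h x) \<in> retract_rel Q"
        using that x by (auto simp: retract_rel_iff hD(1))
    qed
    moreover have "(x, x) \<in> retract_rel P"
      using x by (simp add: retract_rel_iff)
    ultimately show ?thesis
      by blast
  qed
  have mem: "h x \<in> fst Q" if "x \<in> fst P" for x
    using that hD(1) by simp
  show ?thesis
  proof (rule solution_epiI)
    show "fst (ret Q) = ?g ` fst (ret P)"
      unfolding dD(1) cD(1) hD(1) image_image using g by (intro image_cong) auto
  next
    fix A B
    assume "A \<in> fst (ret P)" "B \<in> fst (ret P)"
    then obtain x y where xy: "x \<in> fst P" "y \<in> fst P" and AB: "A = ?c x" "B = ?c y"
      unfolding cD(1) by auto
    show "left_op (ret Q) (?g A) (?g B) = ?g (left_op (ret P) A B)"
      unfolding AB g[OF xy(1)] g[OF xy(2)] cD(2)[OF xy] dD(2)[OF mem[OF xy(1)] mem[OF xy(2)]]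
        hD(2)[OF xy] g[OF PD(3)[OF xy]] ..
    show "right_op (ret Q) (?g B) (?g A) = ?g (right_op (ret P) B A)"
      unfolding AB g[OF xy(1)] g[OF xy(2)] cD(3)[OF xy] dD(3)[OF mem[OF xy(1)] mem[OF xy(2)]]
        hD(3)[OF xy] g[OF PD(6)[OF xy]] ..
  qed
qed

section \<open>Iterated retraction\<close>

lemma inj_on_Class:
  assumes "square_free_solution P"
  shows "inj_on (Class \<circ> Abs_fset) (fst (ret P))"
proof -
  have "finite A" if "A \<in> fst (ret P)" for A
  proof -
    from that obtain x where "A = retract_rel P `` {x}"
      unfolding solution_epiD(1)[OF solution_epi_ret[OF assms]] by auto
    then have "A \<subseteq> fst P"
      by (auto simp: retract_rel_iff)
    then show ?thesis
      using square_free_solutionD(1)[OF assms] by (rule finite_subset)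
  qed
  then show ?thesis
    by (auto simp: inj_on_def Abs_fset_inject)
qed

lemma square_free_solution_transport:
  assumes "square_free_solution P" and "inj_on h (fst P)"
  shows "square_free_solution (transport h P)"
  using assms square_free_solution_image solution_epi_transport(1) by blast

lemma solution_epi_transport_induced:
  assumes P: "square_free_solution P" and Q: "square_free_solution Q"
    and h: "solution_epi h P Q"
    and "inj_on i (fst P)" and "inj_on j (fst Q)"
  shows "\<exists>h'. solution_epi h' (transport i P) (transport j Q)"
  using solution_epi_comp[OF solution_epi_comp[OF solution_epi_transport(2)[OF P assms(4)] h]
      solution_epi_transport(1)[OF Q assms(5)]]
  by blast

lemma square_free_solution_ret_iter:
  assumes "square_free_solution P"
  shows "square_free_solution (ret_iter k P)"
proof (induction k)
  case 0
  show ?case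
    using square_free_solution_transport[OF assms, of Point] by (simp add: ret_iter_def inj_on_def)
next
  case (Suc k)
  let ?Q = "ret_iter k P"
  have "square_free_solution (ret ?Q)"
    using Suc square_free_solution_image solution_epi_ret by blast
  then have "square_free_solution (transport (Class \<circ> Abs_fset) (ret ?Q))"
    using inj_on_Class[OF Suc] by (rule square_free_solution_transport)
  then show ?case
    by (simp add: ret_iter_def)
qed

lemma solution_epi_ret_iter:
  assumes P: "square_free_solution P" and h: "solution_epi h P Q"
  shows "\<exists>h'. solution_epi h' (ret_iter k P) (ret_iter k Q)"
proof -
  have Q: "square_free_solution Q"
    by (rule square_free_solution_image[OF P h])
  show ?thesis
  proof (induction k)
    case 0
    show ?case
      using solution_epi_transport_induced[OF P Q h, of Point Point]
      by (simp add: ret_iter_def inj_on_def)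
  next
    case (Suc k)
    then obtain h' where h': "solution_epi h' (ret_iter k P) (ret_iter k Q)"
      by blast
    note Pk = square_free_solution_ret_iter[OF P, of k]
      and Qk = square_free_solution_ret_iter[OF Q, of k]
    have "\<exists>h''. solution_epi h'' (transport (Class \<circ> Abs_fset) (ret (ret_iter k P)))
        (transport (Class \<circ> Abs_fset) (ret (ret_iter k Q)))"
      using solution_epi_transport_induced[OF
          square_free_solution_image[OF Pk solution_epi_ret[OF Pk]]
          square_free_solution_image[OF Qk solution_epi_ret[OF Qk]]
          solution_epi_ret_induced[OF Pk h'] inj_on_Class[OF Pk] inj_on_Class[OF Qk]] .
    then show ?case
      by (simp add: ret_iter_def)
  qed
qed

lemma multipermutation_solution_image:
  assumes P: "square_free_solution P" and h: "solution_epi h P Q"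
    and "multipermutation_solution P"
  shows "multipermutation_solution Q"
proof -
  from assms(3) obtain m where m: "m > 0" "card (fst (ret_iter m P)) = 1"
    by (auto simp: multipermutation_solution_def)
  obtain h' where "solution_epi h' (ret_iter m P) (ret_iter m Q)"
    using solution_epi_ret_iter[OF P h] by blast
  then have "fst (ret_iter m Q) = h' ` fst (ret_iter m P)"
    by (rule solution_epiD(1))
  then have "card (fst (ret_iter m Q)) = 1"
    using m(2) by (auto simp: card_1_singleton_iff)
  then show ?thesis
    using m(1) by (auto simp: multipermutation_solution_def)
qed

text \<open>The right operations are the inverse left translations, so a map that respects the
  cycle set operations respects both components of the solutions.\<close>

lemma solution_epi_cycle_solution:
  assumes X: "finite X" "cycle_set X f" "square_free X f"
    and Y: "finite Y" "cycle_set Y g" "square_free Y g"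
    and onto: "h ` X = Y"
    and hom: "\<And>x y. x \<in> X \<Longrightarrow> y \<in> X \<Longrightarrow> h (f x y) = g (h x) (h y)"
  shows "solution_epi h (cycle_solution X f) (cycle_solution Y g)"
proof (rule solution_epiI)
  let ?P = "cycle_solution X f" and ?Q = "cycle_solution Y g"
  note P = square_free_solution_cycle_solution[OF X]
    and Q = square_free_solution_cycle_solution[OF Y]
  note PD = square_free_solutionD[OF P(1)] and QD = square_free_solutionD[OF Q(1)]
  have fst_P: "fst ?P = X" and fst_Q: "fst ?Q = Y"
    by (simp_all add: cycle_solution_def)
  show "fst ?Q = h ` fst ?P"
    using onto by (simp add: fst_P fst_Q)
  have left: "left_op ?Q (h x) (h y) = h (left_op ?P x y)" if "x \<in> X" "y \<in> X" for x y
    using that onto hom P(2) Q(2) by auto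
  then show "left_op ?Q (h x) (h y) = h (left_op ?P x y)" if "x \<in> fst ?P" "y \<in> fst ?P" for x y
    using that fst_P by simp
  show "right_op ?Q (h y) (h x) = h (right_op ?P y x)"
    if xy: "x \<in> fst ?P" "y \<in> fst ?P" for x y
  proof -
    have mem: "h x \<in> Y" "h y \<in> Y" "h (right_op ?P y x) \<in> Y"
      using xy onto PD(6)[OF xy] by (auto simp: fst_P)
    have "left_op ?Q (h y) (h (right_op ?P y x)) = h x"
      using left xy PD(6,7)[OF xy] by (simp add: fst_P)
    also have "\<dots> = left_op ?Q (h y) (right_op ?Q (h y) (h x))"
      using QD(7) mem by (simp add: fst_Q)
    finally have "left_op ?Q (h y) (right_op ?Q (h y) (h x)) = left_op ?Q (h y) (h (right_op ?P y x))"
      by (rule sym)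
    moreover have "inj_on (left_op ?Q (h y)) Y"
      using QD(2) mem by (simp add: fst_Q bij_betw_def)
    moreover have "right_op ?Q (h y) (h x) \<in> Y"
      using QD(6) mem by (simp add: fst_Q)
    ultimately show ?thesis
      using mem(3) by (metis inj_onD)
  qed
qed

section \<open>Dynamical extensions\<close>

lemma cycle_set_dyn_ext_op:
  assumes "finite X" and cs: "cycle_set X f" and "finite S"
    and \<alpha>: "dynamical_cocycle X f S \<alpha>"
  shows "cycle_set (S \<times> X) (dyn_ext_op f \<alpha>)"
proof -
  have bij: "bij_betw (dyn_ext_op f \<alpha> (s, x)) (S \<times> X) (S \<times> X)" if s: "s \<in> S" and x: "x \<in> X" for s x
  proof -
    have fx: "bij_betw (f x) X X"
      using cs x by (simp add: cycle_set_def)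
    have \<alpha>x: "bij_betw (\<alpha> x y s) S S" if "y \<in> X" for y
      using \<alpha> x s that by (simp add: dynamical_cocycle_def)
    have inj: "inj_on (dyn_ext_op f \<alpha> (s, x)) (S \<times> X)"
    proof (rule inj_onI)
      fix p q
      assume p: "p \<in> S \<times> X" and q: "q \<in> S \<times> X"
        and eq: "dyn_ext_op f \<alpha> (s, x) p = dyn_ext_op f \<alpha> (s, x) q"
      have "snd p = snd q"
        using fx p q eq by (auto simp: dyn_ext_op_def bij_betw_def dest: inj_onD)
      moreover from this have "fst p = fst q"
        using \<alpha>x[of "snd p"] p q eq by (auto simp: dyn_ext_op_def bij_betw_def dest: inj_onD)
      ultimately show "p = q"
        by (simp add: prod_eq_iff)
    qed
    moreover have "dyn_ext_op f \<alpha> (s, x) ` (S \<times> X) \<subseteq> S \<times> X"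
      using bij_betw_apply[OF fx] bij_betw_apply[OF \<alpha>x] by (auto simp: dyn_ext_op_def)
    ultimately show ?thesis
      using \<open>finite X\<close> \<open>finite S\<close> by (simp add: bij_betw_def endo_inj_surj)
  qed
  have \<alpha>_law: "\<alpha> (f x y) (f x z) (\<alpha> x y r s) (\<alpha> x z r t) = \<alpha> (f y x) (f y z) (\<alpha> y x s r) (\<alpha> y z s t)"
    if "x \<in> X" "y \<in> X" "z \<in> X" "r \<in> S" "s \<in> S" "t \<in> S" for x y z r s t
    using \<alpha> that unfolding dynamical_cocycle_def by blast
  have f_law: "f (f x y) (f x z) = f (f y x) (f y z)" if "x \<in> X" "y \<in> X" "z \<in> X" for x y z
    using cs that unfolding cycle_set_def by blast
  show ?thesis
    unfolding cycle_set_def using bij by (auto simp: dyn_ext_op_def intro: \<alpha>_law f_law)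
qed

theorem lemma3p11:
  fixes X :: "'x set" and f :: "'x \<Rightarrow> 'x \<Rightarrow> 'x"
    and S :: "'s set" and \<alpha> :: "'x \<Rightarrow> 'x \<Rightarrow> 's \<Rightarrow> 's \<Rightarrow> 's"
  assumes "finite X" and "cycle_set X f" and "square_free X f"
    and "finite S" and "S \<noteq> {}"
    and "dynamical_cocycle X f S \<alpha>"
    and "\<And>x s. x \<in> X \<Longrightarrow> s \<in> S \<Longrightarrow> \<alpha> x x s s = s"
    and "\<not> multipermutation_cycle_set X f"
  shows "square_free (S \<times> X) (dyn_ext_op f \<alpha>) \<and>
         \<not> multipermutation_cycle_set (S \<times> X) (dyn_ext_op f \<alpha>)"
proof -
  let ?E = "cycle_solution (S \<times> X) (dyn_ext_op f \<alpha>)"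
  have fin: "finite (S \<times> X)"
    using assms(1,4) by simp
  have cs: "cycle_set (S \<times> X) (dyn_ext_op f \<alpha>)"
    using assms(1,2,4,6) by (rule cycle_set_dyn_ext_op)
  have sf: "square_free (S \<times> X) (dyn_ext_op f \<alpha>)"
    using assms(3,7) by (auto simp: square_free_def dyn_ext_op_def)
  have epi: "solution_epi snd ?E (cycle_solution X f)"
    using fin cs sf assms(1-3)
  proof (rule solution_epi_cycle_solution)
    show "snd ` (S \<times> X) = X"
      using assms(5) by auto
  qed (auto simp: dyn_ext_op_def)
  have "\<not> multipermutation_solution ?E"
    using multipermutation_solution_image[OF square_free_solution_cycle_solution(1)[OF fin cs sf] epi]
      assms(8) by (auto simp: multipermutation_cycle_set_def)
  then show ?thesis
    using sf by (simp add: multipermutation_cycle_set_def)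
qed

end
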